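(* Let $n\ge 1$ and let $s=a_1a_2\cdots a_n$ be a permutation of $[n]$ in one-line form. Then $$bid(s)\geq \frac{\max_{\gamma}\{|C(p_t\bar{s} \gamma)-C(\gamma)|\}}{2},$$ where $\gamma$ ranges over all permutations of $[n]^*=\{0,1,\dots,n\}$.
   Context: $[n]=\{1,\dots,n\}$. A block-interchange on a sequence $a_1\cdots a_n$ swaps two disjoint, not necessarily adjacent, blocks: for some $1\le i\le j<k\le l\le n$ it changes the sequence into $a_1\cdots a_{i-1}\,a_k\cdots a_l\,a_{j+1}\cdots a_{k-1}\,a_i\cdots a_j\,a_{l+1}\cdots a_n$. The block-interchange distance $bid(s)$ is the minimum number of block-interchanges needed to transform $s$ into $e_n=12\cdots n$. In cycle notation on $[n]^*$, $\bar s=(0~a_1~a_2~\cdots~a_n)$ and $p_t=(n~n-1~\cdots~1~0)$. $C(\pi)$ denotes the number of cycles of a permutation $\pi$ (fixed points included). Products of permutations are compositions of maps (right to left). *)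

theory Defs
  imports
    Complex_Main
    "HOL-Combinatorics.Cycles"
    "HOL-Combinatorics.Orbits"
    "HOL-Combinatorics.Multiset_Permutations"
begin

(* Positions are 1-based: a_p ... a_q is the list drop (p - 1) (take q s). *)
definition block_interchange :: "nat \<Rightarrow> nat \<Rightarrow> nat \<Rightarrow> nat \<Rightarrow> 'a list \<Rightarrow> 'a list" where
  "block_interchange i j k l s =
     take (i - 1) s
     @ drop (k - 1) (take l s)
     @ drop j (take (k - 1) s)
     @ drop (i - 1) (take j s)
     @ drop l s"

definition block_interchange_rel :: "'a list rel" where
  "block_interchange_rel =
     {(s, t). \<exists>i j k l. 1 \<le> i \<and> i \<le> j \<and> j < k \<and> k \<le> l \<and> l \<le> length s
                \<and> t = block_interchange i j k l s}"

(* The minimum is over a nonempty set for every permutation s of {1..n};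
   see block_interchange_sortable below. *)
definition bid :: "nat list \<Rightarrow> nat" where
  "bid s = (LEAST m. (s, [1..<Suc (length s)]) \<in> block_interchange_rel ^^ m)"

definition s_bar :: "nat list \<Rightarrow> nat \<Rightarrow> nat" where
  "s_bar s = cycle_of_list (0 # s)"

definition p_t :: "nat \<Rightarrow> nat \<Rightarrow> nat" where
  "p_t n = cycle_of_list (rev [0..<Suc n])"

(* The set A is explicit because a permutation of A, as a total function,
   also fixes every point outside A. *)
definition num_cycles :: "'a set \<Rightarrow> ('a \<Rightarrow> 'a) \<Rightarrow> nat" where
  "num_cycles A \<pi> = card (orbit \<pi> ` A)"

lemma swap_in_block_interchange_rel:
  "(A @ x # M @ y # B, A @ y # M @ x # B) \<in> block_interchange_rel"
proof -
  let ?i = "Suc (length A)" and ?k = "Suc (Suc (length A + length M))"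
  have "A @ y # M @ x # B = block_interchange ?i ?i ?k ?k (A @ x # M @ y # B)"
    by (simp add: block_interchange_def)
  moreover have "?k \<le> length (A @ x # M @ y # B)" by simp
  ultimately show ?thesis
    unfolding block_interchange_rel_def
    by (intro CollectI case_prodI exI[of _ ?i] exI[of _ ?k]) simp
qed

lemma mset_eq_imp_block_interchange_rtrancl:
  "mset xs = mset ys \<Longrightarrow> (P @ xs, P @ ys) \<in> block_interchange_rel\<^sup>*"
proof (induction ys arbitrary: xs P)
  case Nil
  then show ?case by simp
next
  case (Cons y ys)
  have "y \<in> set xs" using Cons.prems by (metis list.set_intros(1) set_mset_mset)
  then obtain U V where xs: "xs = U @ y # V" by (meson split_list)
  show ?case
  proof (cases U)
    case Nil
    then have "mset V = mset ys" using Cons.prems xs by simp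
    from Cons.IH[OF this, of "P @ [y]"] show ?thesis using xs Nil by simp
  next
    case (Cons u U')
    then have "mset (U' @ u # V) = mset ys" using Cons.prems xs by simp
    from Cons.IH[OF this, of "P @ [y]"]
    have "(P @ y # U' @ u # V, P @ y # ys) \<in> block_interchange_rel\<^sup>*" by simp
    moreover have "(P @ xs, P @ y # U' @ u # V) \<in> block_interchange_rel"
      using swap_in_block_interchange_rel[of P u U' y V] xs Cons by simp
    ultimately show ?thesis by (rule converse_rtrancl_into_rtrancl[rotated])
  qed
qed

lemma block_interchange_sortable:
  assumes "s \<in> permutations_of_set {1..n}"
  shows "\<exists>m. (s, [1..<Suc (length s)]) \<in> block_interchange_rel ^^ m"
proof -
  have s: "set s = {1..n}" "distinct s"
    using assms by (auto dest: permutations_of_setD)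
  then have "length s = n" using distinct_card[of s] by simp
  moreover have "set s = set [1..<Suc n]" by (simp add: s(1) atLeastLessThanSuc_atLeastAtMost del: upt_Suc)
  then have "mset s = mset [1..<Suc n]"
    using set_eq_iff_mset_eq_distinct[OF s(2) distinct_upt] by blast
  then have "([] @ s, [] @ [1..<Suc n]) \<in> block_interchange_rel\<^sup>*"
    by (rule mset_eq_imp_block_interchange_rtrancl)
  ultimately have "(s, [1..<Suc (length s)]) \<in> block_interchange_rel\<^sup>*"
    by (simp del: upt_Suc)
  then show ?thesis by (simp only: rtrancl_power)
qed

end

(* A block-interchange multiplies s_bar by two transpositions. Sorting s in m steps therefore
   writes p_t s_bar as a product of 2m transpositions, because p_t inverts the long cycle
   (0 1 ... n), and multiplying a permutation by a transposition changes its number of cycles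
   by at most one. *)
theory Submission
  imports Defs
begin

section \<open>Cycle counts under multiplication by a transposition\<close>

text \<open>Along an orbit of \<open>f\<close> that avoids \<open>a\<close> and \<open>b\<close>,
  every value of \<open>f\<close> stays in that orbit, so the transposition never acts.\<close>

lemma orbit_transpose_comp_eq:
  assumes "permutation f" "a \<notin> orbit f x" "b \<notin> orbit f x"
  shows "orbit (transpose a b \<circ> f) x = orbit f x"
proof (rule orbit_cong)
  show "x \<in> orbit f x" using assms(1) by (rule permutation_self_in_orbit)
  fix y assume "y \<in> orbit f x"
  then have "f y \<in> orbit f x" by (rule orbit.step)
  then show "(transpose a b \<circ> f) y = f y" using assms by (auto simp: transpose_def)
qed

text \<open>An orbit of the product through neither \<open>a\<close> nor \<open>b\<close> is an
  orbit of \<open>f\<close> other than that of \<open>a\<close>. So at most two orbits are new,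
  while at least one old orbit disappears from the bound.\<close>

lemma num_cycles_transpose_comp_le:
  assumes A: "finite A" and f: "f permutes A" and ab: "a \<in> A" "b \<in> A"
  shows "num_cycles A (transpose a b \<circ> f) \<le> Suc (num_cycles A f)"
proof -
  define g where "g = transpose a b \<circ> f"
  have pf: "permutation f" using f A by (auto simp: permutation_permutes)
  have pg: "permutation g" unfolding g_def using pf by (intro permutation_compose permutation_swap_id)
  have fg: "f = transpose a b \<circ> g" by (simp add: g_def fun_eq_iff)
  have "orbit g ` A \<subseteq> insert (orbit g b) (insert (orbit g a) (orbit f ` A - {orbit f a}))"
  proof
    fix O' assume "O' \<in> orbit g ` A"
    then obtain x where x: "x \<in> A" "O' = orbit g x" by blast
    show "O' \<in> insert (orbit g b) (insert (orbit g a) (orbit f ` A - {orbit f a}))"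
    proof (cases "a \<in> orbit g x \<or> b \<in> orbit g x")
      case True
      then show ?thesis
        using orbit_cyclic_eq3[OF cyclic_on_orbit'[OF pg]] x by blast
    next
      case False
      then have eq: "orbit f x = orbit g x"
        using orbit_transpose_comp_eq[OF pg] fg by metis
      moreover have "orbit f a \<noteq> orbit g x"
        using permutation_self_in_orbit[OF pf, of a] False by auto
      ultimately show ?thesis using x by auto
    qed
  qed
  then have "card (orbit g ` A) \<le> card (insert (orbit g b) (insert (orbit g a) (orbit f ` A - {orbit f a})))"
    by (intro card_mono) (auto simp: A)
  also have "\<dots> \<le> Suc (Suc (card (orbit f ` A - {orbit f a})))"
    by (simp add: card_insert_if A)
  \<comment> \<open>Since \<open>a\<close> lies in \<open>A\<close>, the removed orbit is one of
    those counted.\<close>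
  also have "\<dots> = Suc (card (orbit f ` A))"
    using ab A by (subst card_Suc_Diff1) auto
  finally show ?thesis by (simp add: num_cycles_def g_def)
qed

text \<open>A transposition is an involution, so the one-sided bound, applied once more to the
  product, also gives the reverse direction.\<close>

lemma num_cycles_transpose_comp:
  assumes "finite A" "f permutes A" "a \<in> A" "b \<in> A"
  shows "\<bar>int (num_cycles A (transpose a b \<circ> f)) - int (num_cycles A f)\<bar> \<le> 1"
proof -
  have "transpose a b \<circ> f permutes A"
    using assms by (intro permutes_compose permutes_swap_id)
  from num_cycles_transpose_comp_le[OF assms(1) this assms(3,4)]
  have "num_cycles A f \<le> Suc (num_cycles A (transpose a b \<circ> f))"
    by (simp flip: comp_assoc)
  with num_cycles_transpose_comp_le[OF assms] show ?thesis by linarith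
qed

section \<open>Cycles written as lists\<close>

text \<open>Rotating \<open>x\<close> to the front leaves the cycle unchanged. The head of
  \<open>zs @ xs @ [x]\<close> is the cyclic successor of \<open>x\<close>: it wraps around for
  empty \<open>zs\<close> and is \<open>x\<close> itself in a one-element list.\<close>

lemma cycle_of_list_apply:
  assumes "distinct (xs @ x # zs)"
  shows "cycle_of_list (xs @ x # zs) x = hd (zs @ xs @ [x])"
proof -
  have "cycle_of_list (xs @ x # zs) = cycle_of_list (x # zs @ xs)"
    using cycle_of_list_rotate_independent[OF assms, of "length xs"] by (simp add: rotate_append)
  moreover have "map (cycle_of_list (x # zs @ xs)) (x # zs @ xs) = zs @ xs @ [x]"
    using cyclic_rotation[of "x # zs @ xs" 1] assms by auto
  ultimately show ?thesis by (metis list.sel(1) list.simps(9))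
qed

lemma cycle_of_list_append_last:
  assumes "distinct (P @ Q @ R)" "Q \<noteq> []"
  shows "cycle_of_list (P @ Q @ R) (last Q) = hd (R @ P @ Q)"
proof -
  obtain Q' q where "Q = Q' @ [q]" using assms(2) by (metis append_butlast_last_id)
  then show ?thesis using cycle_of_list_apply[of "P @ Q'" q R] assms(1) by simp
qed

text \<open>The successor of a non-final entry of \<open>Q\<close> again lies in \<open>Q\<close>,
  so it does not depend on where the block stands.\<close>

lemma cycle_of_list_append_inner:
  assumes "distinct (P @ Q @ R)" "x \<in> set Q" "x \<noteq> last Q"
  shows "cycle_of_list (P @ Q @ R) x = cycle_of_list Q x"
proof -
  obtain Q1 Q2 where Q: "Q = Q1 @ x # Q2" using assms(2) by (meson split_list)
  with assms(3) have "Q2 \<noteq> []" by auto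
  then show ?thesis
    using cycle_of_list_apply[of "P @ Q1" x "Q2 @ R"] cycle_of_list_apply[of Q1 x Q2] assms(1) Q
    by (auto simp: Int_Un_distrib)
qed

lemma cycle_of_list_rev_comp:
  assumes "distinct xs"
  shows "cycle_of_list (rev xs) \<circ> cycle_of_list xs = id"
proof
  fix x
  show "(cycle_of_list (rev xs) \<circ> cycle_of_list xs) x = id x"
  proof (cases "x \<in> set xs")
    case False
    then show ?thesis by (simp add: id_outside_supp)
  next
    case True
    then obtain P R where xs: "xs = P @ x # R" by (meson split_list)
    show ?thesis
    proof (cases R)
      \<comment> \<open>\<open>x\<close> is sent to \<open>y\<close>, and in the reversed list
        \<open>x\<close> comes right after \<open>y\<close>.\<close>
      case (Cons y R')
      then show ?thesis
        using cycle_of_list_apply[of P x R] cycle_of_list_apply[of "rev R'" y "x # rev P"] assms xs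
        by auto
    next
      \<comment> \<open>Here \<open>x\<close> ends the list and is sent to its first entry, which
        ends the reversed list and wraps around to \<open>x\<close>.\<close>
      case Nil
      show ?thesis
      proof (cases P)
        case (Cons y P')
        then show ?thesis
          using Nil cycle_of_list_apply[of P x R] cycle_of_list_apply[of "x # rev P'" y "[]"] assms xs
          by auto
      qed (use Nil xs in simp)
    qed
  qed
qed

section \<open>Interchanging two blocks of a cycle\<close>

lemma cycle_of_list_block_interchange:
  assumes d: "distinct (A @ B @ C @ D @ E)" and ne: "A \<noteq> []" "B \<noteq> []" "D \<noteq> []"
  shows "cycle_of_list (A @ D @ C @ B @ E) =
    cycle_of_list (A @ B @ C @ D @ E) \<circ> (transpose (last A) (last (B @ C)) \<circ> transpose (last B) (last D))"
    (is "?t = ?s \<circ> (?u \<circ> ?v)")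
proof
  fix x
  (* Both cycles agree except at the last elements of A, B, C and D. For empty C the two
     transpositions share last B and their product is a 3-cycle. *)
  have d': "distinct (A @ D @ C @ B @ E)" using d by auto
  have inner: "?t x = ?s x" if "x \<in> set Q" "x \<noteq> last Q" "Q \<in> {A, B, C, D, E}" for Q
  proof -
    have "?t x = cycle_of_list Q x"
      using that d' cycle_of_list_append_inner[of "[]" A "D @ C @ B @ E"]
        cycle_of_list_append_inner[of "A" D "C @ B @ E"]
        cycle_of_list_append_inner[of "A @ D" C "B @ E"]
        cycle_of_list_append_inner[of "A @ D @ C" B "E"]
        cycle_of_list_append_inner[of "A @ D @ C @ B" E "[]"] by auto
    moreover have "?s x = cycle_of_list Q x"
      using that d cycle_of_list_append_inner[of "[]" A "B @ C @ D @ E"]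
        cycle_of_list_append_inner[of "A" B "C @ D @ E"]
        cycle_of_list_append_inner[of "A @ B" C "D @ E"]
        cycle_of_list_append_inner[of "A @ B @ C" D "E"]
        cycle_of_list_append_inner[of "A @ B @ C @ D" E "[]"] by auto
    ultimately show ?thesis by simp
  qed
  \<comment> \<open>\<open>C\<close> and \<open>E\<close> may be empty: then
    \<open>hd (C @ B)\<close> is the first entry of \<open>B\<close>, and \<open>hd (E @ A)\<close>
    wraps around to \<open>A\<close>.\<close>
  have t_last: "?t (last A) = hd D" "?t (last D) = hd (C @ B)" "?t (last B) = hd (E @ A)"
    "C \<noteq> [] \<Longrightarrow> ?t (last C) = hd B"
    using cycle_of_list_append_last[of "[]" A "D @ C @ B @ E"]
      cycle_of_list_append_last[of "A" D "C @ B @ E"]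
      cycle_of_list_append_last[of "A @ D @ C" B "E"]
      cycle_of_list_append_last[of "A @ D" C "B @ E"] d' ne
    by (simp_all add: hd_append)
  \<comment> \<open>Comparison with \<open>t_last\<close> shows where the transpositions come from:
    for nonempty \<open>C\<close>, the values at \<open>last A\<close> and \<open>last C\<close>
    trade places, and so do those at \<open>last B\<close> and \<open>last D\<close>.\<close>
  have s_last: "?s (last A) = hd B" "?s (last (B @ C)) = hd D" "?s (last D) = hd (E @ A)"
    "C \<noteq> [] \<Longrightarrow> ?s (last B) = hd C"
    using cycle_of_list_append_last[of "[]" A "B @ C @ D @ E"]
      cycle_of_list_append_last[of "A" "B @ C" "D @ E"]
      cycle_of_list_append_last[of "A @ B @ C" D "E"]
      cycle_of_list_append_last[of "A" B "C @ D @ E"] d ne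
    by (simp_all add: hd_append)
  \<comment> \<open>Both cycles wrap around from the end of \<open>E\<close> to the first entry of
    \<open>A\<close>.\<close>
  have E_last: "?t (last E) = ?s (last E)" if "E \<noteq> []"
    using cycle_of_list_append_last[of "A @ D @ C @ B" E "[]"]
      cycle_of_list_append_last[of "A @ B @ C @ D" E "[]"] d d' ne that
    by simp
  have lasts: "last A \<in> set A" "last B \<in> set B" "last D \<in> set D" "last (B @ C) \<in> set (B @ C)"
    using ne by (auto simp: last_append)
  have disj: "set A \<inter> set (B @ C) = {}" "set A \<inter> set D = {}" "set B \<inter> set C = {}"
    "set (B @ C) \<inter> set D = {}" "set E \<inter> set (A @ B @ C @ D) = {}"
    using d by auto
  have neq: "last A \<noteq> last B" "last A \<noteq> last D" "last B \<noteq> last D"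
    "last A \<noteq> last (B @ C)" "last (B @ C) \<noteq> last D"
    using lasts disj by (auto dest: disjoint_iff[THEN iffD1])
  have BC: "last (B @ C) = last C \<and> last B \<noteq> last C" if "C \<noteq> []"
    using lasts(2) last_in_set[OF that] disj(3) that by auto
  have off: "?t x = (?s \<circ> (?u \<circ> ?v)) x"
    if "?t x = ?s x" "x \<noteq> last A" "x \<noteq> last B" "x \<noteq> last D" "x \<noteq> last (B @ C)"
    using that by (simp add: transpose_def)
  \<comment> \<open>\<open>last C\<close> is unspecified for empty \<open>C\<close>, hence the
    guards on it.\<close>
  consider "x = last A" | "x = last B" | "x = last D" | "x = last C" "C \<noteq> []"
    | "x \<noteq> last A" "x \<noteq> last B" "x \<noteq> last D" "x \<noteq> last (B @ C)" "x \<in> set C \<Longrightarrow> x \<noteq> last C"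
    using last_append by (metis empty_iff list.set(1))
  then show "?t x = (?s \<circ> (?u \<circ> ?v)) x"
  proof cases
    case 1
    then show ?thesis using neq t_last(1) s_last(2) by (simp add: transpose_def)
  next
    case 2
    then show ?thesis using neq t_last(3) s_last(3) by (simp add: transpose_def)
  next
    case 3
    show ?thesis
    proof (cases "C = []")
      case True
      then show ?thesis using 3 neq t_last(2) s_last(1) by (simp add: transpose_def)
    next
      case False
      then show ?thesis using 3 neq BC t_last(2) s_last(4) by (simp add: transpose_def)
    qed
  next
    case 4
    then have "last C \<noteq> last A" "last C \<noteq> last B" "last C \<noteq> last D"
      using BC neq(4,5) by metis+
    then show ?thesis using 4 BC t_last(4) s_last(1) by (simp add: transpose_def)
  next
    case 5
    have "?t x = ?s x"
    proof (cases "x \<in> set (A @ B @ C @ D @ E)")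
      case False
      then have "?t x = x" "?s x = x" by (auto intro!: id_outside_supp)
      then show ?thesis by simp
    next
      case True
      then show ?thesis
        using inner[of A] inner[of B] inner[of C] inner[of D] inner[of E] 5 E_last
        by (cases "x = last E \<and> E \<noteq> []") auto
    qed
    then show ?thesis using 5(1-4) by (rule off)
  qed
qed

section \<open>Block-interchanges as factors of \<open>s_bar\<close>\<close>

text \<open>The list is cut after the positions \<open>i - 1\<close>, \<open>j\<close>,
  \<open>k - 1\<close> and \<open>l\<close>. The bounds \<open>i \<le> j\<close> and
  \<open>k \<le> l\<close> make the two exchanged blocks nonempty; the other three may be
  empty.\<close>

lemma block_interchange_relE:
  assumes "(s, t) \<in> block_interchange_rel"
  obtains A B C D E where "s = A @ B @ C @ D @ E" "t = A @ D @ C @ B @ E" "B \<noteq> []" "D \<noteq> []"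
proof -
  obtain i j k l where ijkl: "1 \<le> i" "i \<le> j" "j < k" "k \<le> l" "l \<le> length s"
    and t: "t = block_interchange i j k l s"
    using assms unfolding block_interchange_rel_def by blast
  have cut: "take q s = take p s @ drop p (take q s)" if "p \<le> q" for p q
    using that by (metis append_take_drop_id min.absorb1 take_take)
  show ?thesis
  proof
    show "t = take (i - 1) s @ drop (k - 1) (take l s) @ drop j (take (k - 1) s)
        @ drop (i - 1) (take j s) @ drop l s"
      using t by (simp add: block_interchange_def)
    have "s = take l s @ drop l s" by simp
    also have "take l s = take (k - 1) s @ drop (k - 1) (take l s)" using ijkl by (intro cut) simp
    also have "take (k - 1) s = take j s @ drop j (take (k - 1) s)" using ijkl by (intro cut) simp
    also have "take j s = take (i - 1) s @ drop (i - 1) (take j s)" using ijkl by (intro cut) simp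
    finally show "s = take (i - 1) s @ drop (i - 1) (take j s) @ drop j (take (k - 1) s)
        @ drop (k - 1) (take l s) @ drop l s" by (simp only: append_assoc)
  qed (use ijkl in auto)
qed

lemma s_bar_block_interchange:
  assumes "(s, t) \<in> block_interchange_rel" "distinct s" "0 \<notin> set s"
  obtains a b c d where "{a, b, c, d} \<subseteq> insert 0 (set s)"
    "s_bar s = s_bar t \<circ> transpose a b \<circ> transpose c d"
proof -
  obtain A B C D E where st: "s = A @ B @ C @ D @ E" "t = A @ D @ C @ B @ E" "B \<noteq> []" "D \<noteq> []"
    using assms(1) by (rule block_interchange_relE)
  show ?thesis
  proof
    \<comment> \<open>The leading 0 makes the first block nonempty. The roles of \<open>B\<close>
      and \<open>D\<close> are exchanged, so the cycle of \<open>s\<close> is expressed through that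
      of \<open>t\<close>.\<close>
    have "distinct ((0 # A) @ D @ C @ B @ E)" using assms st by auto
    from cycle_of_list_block_interchange[OF this] st
    show "s_bar s = s_bar t \<circ> transpose (last (0 # A)) (last (D @ C)) \<circ> transpose (last D) (last B)"
      by (simp add: s_bar_def comp_assoc)
    have "last (0 # A) \<in> set (0 # A)" "last (D @ C) \<in> set (D @ C)" "last B \<in> set B" "last D \<in> set D"
      using st(3,4) by (auto simp: last_append)
    then show "{last (0 # A), last (D @ C), last D, last B} \<subseteq> insert 0 (set s)"
      using st(1) by auto
  qed
qed

section \<open>The lower bound from a sorting sequence\<close>

lemma permutations_of_set_block_interchange:
  assumes "(s, t) \<in> block_interchange_rel" "s \<in> permutations_of_set S"
  shows "t \<in> permutations_of_set S"
  using assms by (elim block_interchange_relE) (auto simp: permutations_of_set_def)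

lemma p_t_comp_s_bar_sorted: "p_t n \<circ> s_bar [1..<Suc n] = id"
proof -
  have "0 # [1..<Suc n] = [0..<Suc n]" by (simp add: upt_conv_Cons del: upt_Suc)
  then show ?thesis
    unfolding p_t_def s_bar_def by (simp add: cycle_of_list_rev_comp del: upt_Suc)
qed

text \<open>The two transpositions of the first step stand directly to the left of
  \<open>\<gamma>\<close> and are absorbed into it. The induction therefore needs arbitrary
  \<open>\<gamma>\<close>, and each step costs at most 2.\<close>

lemma num_cycles_diff_le_sorting_length:
  assumes "s \<in> permutations_of_set {1..n}" "(s, [1..<Suc n]) \<in> block_interchange_rel ^^ m"
    and "\<gamma> permutes {0..n}"
  shows "\<bar>int (num_cycles {0..n} (p_t n \<circ> s_bar s \<circ> \<gamma>)) - int (num_cycles {0..n} \<gamma>)\<bar> \<le> 2 * int m"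
  using assms
proof (induction m arbitrary: s \<gamma>)
  case 0
  then have s: "s = [1..<Suc n]" by (simp del: upt_Suc)
  show ?case unfolding s p_t_comp_s_bar_sorted by simp
next
  case (Suc m)
  from Suc.prems(2) obtain t where t: "(s, t) \<in> block_interchange_rel"
    "(t, [1..<Suc n]) \<in> block_interchange_rel ^^ m" by (rule relpow_Suc_E2)
  have s: "set s = {1..n}" "distinct s" using Suc.prems(1) by (auto dest: permutations_of_setD)
  then have "0 \<notin> set s" by simp
  then obtain a b c d where abcd: "{a, b, c, d} \<subseteq> insert 0 (set s)"
    "s_bar s = s_bar t \<circ> transpose a b \<circ> transpose c d"
    by (rule s_bar_block_interchange[OF t(1) s(2)])
  then have in_n: "a \<in> {0..n}" "b \<in> {0..n}" "c \<in> {0..n}" "d \<in> {0..n}" using s(1) by auto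
  let ?\<gamma>1 = "transpose c d \<circ> \<gamma>"
  let ?\<gamma>2 = "transpose a b \<circ> ?\<gamma>1"
  have p1: "?\<gamma>1 permutes {0..n}"
    using Suc.prems(3) in_n by (intro permutes_compose permutes_swap_id)
  then have p2: "?\<gamma>2 permutes {0..n}"
    using permutes_swap_id[OF in_n(1,2)] by (rule permutes_compose)
  have eq: "p_t n \<circ> s_bar s \<circ> \<gamma> = p_t n \<circ> s_bar t \<circ> ?\<gamma>2"
    by (simp add: abcd(2) comp_assoc)
  \<comment> \<open>The four integers will be the cycle counts of the full product, of
    \<open>?\<gamma>2\<close>, of \<open>?\<gamma>1\<close> and of \<open>\<gamma>\<close>.\<close>
  have triangle: "\<lbrakk>\<bar>x - y\<bar> \<le> 2 * k; \<bar>y - z\<bar> \<le> 1; \<bar>z - w\<bar> \<le> 1\<rbrakk> \<Longrightarrow> \<bar>x - w\<bar> \<le> 2 * (1 + k)"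
    for x y z w k :: int by (auto simp: abs_le_iff)
  have "\<bar>int (num_cycles {0..n} (p_t n \<circ> s_bar t \<circ> ?\<gamma>2)) - int (num_cycles {0..n} ?\<gamma>2)\<bar> \<le> 2 * int m"
    using permutations_of_set_block_interchange[OF t(1) Suc.prems(1)] t(2) p2 by (rule Suc.IH)
  moreover have "\<bar>int (num_cycles {0..n} ?\<gamma>2) - int (num_cycles {0..n} ?\<gamma>1)\<bar> \<le> 1"
    using finite_atLeastAtMost p1 in_n(1,2) by (rule num_cycles_transpose_comp)
  moreover have "\<bar>int (num_cycles {0..n} ?\<gamma>1) - int (num_cycles {0..n} \<gamma>)\<bar> \<le> 1"
    using finite_atLeastAtMost Suc.prems(3) in_n(3,4) by (rule num_cycles_transpose_comp)
  ultimately show ?case unfolding eq of_nat_Suc by (rule triangle)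
qed

theorem mainTheorem4:
  fixes n :: nat and s :: "nat list"
  assumes "n \<ge> 1" and "s \<in> permutations_of_set {1..n}"
  shows "real (bid s) \<ge>
    real_of_int (Max {\<bar>int (num_cycles {0..n} (p_t n \<circ> s_bar s \<circ> \<gamma>)) - int (num_cycles {0..n} \<gamma>)\<bar>
                      | \<gamma>. \<gamma> permutes {0..n}}) / 2"
    (is "_ \<ge> real_of_int (Max ?M) / 2")
proof -
  have len: "length s = n" using length_finite_permutations_of_set[OF assms(2)] by simp
  \<comment> \<open>Some sorting sequence exists, so the least length is attained.\<close>
  have "(s, [1..<Suc (length s)]) \<in> block_interchange_rel ^^ bid s"
    unfolding bid_def using block_interchange_sortable[OF assms(2)] by (rule LeastI_ex)
  then have sorted: "(s, [1..<Suc n]) \<in> block_interchange_rel ^^ bid s" by (simp only: len)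
  \<comment> \<open>There are finitely many permutations of \<open>{0..n}\<close>, the identity
    among them, so \<open>Max\<close> is a genuine maximum.\<close>
  have "finite ?M" by (simp add: setcompr_eq_image finite_permutations)
  moreover have "?M \<noteq> {}" using permutes_id by blast
  ultimately have "Max ?M \<le> 2 * int (bid s)"
    using num_cycles_diff_le_sorting_length[OF assms(2) sorted] by (intro Max.boundedI) auto
  then show ?thesis by linarith
qed

end
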